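(* Let $f:\mathbb{R}^n\to\mathbb{R}$ be convex and continuously differentiable with $L_1$-Lipschitz gradient, i.e. $\|\nabla f(x)-\nabla f(y)\|\le L_1\|x-y\|$ for all $x,y$. Let the noisy objective be $\tilde f(x;\xi)=f(x)+\nu(x;\xi)$, where for all $x\in\mathbb{R}^n$ the noise $\nu(x;\xi)$ is i.i.d. with $\mathbb{E}_\xi[\nu(x;\xi)]=0$ and variance $\sigma_a^2=\mathrm{Var}(\nu(x;\xi))>0$ (independent of $x$). Let $u\in\mathbb{R}^n$ be a standard Gaussian vector (mean $0$, covariance $I_n$), and let $u,\xi_1,\xi_2$ be independent. For $\mu>0$ define $$\mathcal{E}(\mu)=\left\|\frac{\tilde f(x+\mu u;\xi_1)-\tilde f(x;\xi_2)}{\mu}u-\langle\nabla f(x),u\rangle u\right\|^2 .$$ If $$\mu^*=\left[\frac{8\sigma_a^2 n}{L_1^2(n+6)^3}\right]^{1/4},$$ then for every $x\in\mathbb{R}^n$, $$\mathbb{E}_{u,\xi_1,\xi_2}[\mathcal{E}(\mu^* )]\le \sqrt{2}\,L_1\sigma_a\sqrt{n(n+6)^3}.$$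
   Context: $\|\cdot\|$ is the Euclidean norm and $\langle\cdot,\cdot\rangle$ the Euclidean inner product. The noise values $\nu(\cdot;\xi_1)$ and $\nu(\cdot;\xi_2)$ entering the two evaluations are independent, each with mean $0$ and variance $\sigma_a^2$. *)

theory Defs
  imports "HOL-Probability.Probability"
begin

definition std_gaussian :: "'a::euclidean_space measure" where
  "std_gaussian = density lborel
     (\<lambda>u. ennreal ((2 * pi) powr (- real DIM('a) / 2) * exp (- (norm u)\<^sup>2 / 2)))"

end

theory Submission
  imports Defs "HOL-Real_Asymp.Real_Asymp"
begin

text \<open>
  Taylor's bound for a function with Lipschitz gradient and the independence of the noise reduce
  the claim to the second and the sixth absolute moment of a standard Gaussian vector. Both are
  bounded by means of the moment generating function of \<open>\<parallel>u\<parallel>\<^sup>2\<close>, which equals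
  \<open>(1 - 2 s) powr (- n / 2)\<close>. The given \<open>\<mu>\<close> minimises the resulting bound
  \<open>L1\<^sup>2 \<mu>\<^sup>2 (n + 6)^3 / 4 + 2 \<sigma>\<^sup>2 n / \<mu>\<^sup>2\<close>.
\<close>

section \<open>Quadratic Taylor bound from a Lipschitz gradient\<close>

text \<open>Along the segment from \<open>x\<close> to \<open>x + h\<close> the slope of
  \<open>f\<close> exceeds its initial value by at most \<open>L * t * (norm h)\<^sup>2\<close>, by
  Cauchy-Schwarz and the Lipschitz condition. Monotonicity then replaces integration of this
  estimate over \<open>t\<close>.\<close>

lemma lipschitz_gradient_upper_bound:
  fixes f :: "'a::euclidean_space \<Rightarrow> real"
  assumes deriv: "\<And>y. (f has_derivative (\<lambda>h. grad y \<bullet> h)) (at y)"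
    and lipschitz: "\<And>y z. norm (grad y - grad z) \<le> L * norm (y - z)"
  shows "f (x + h) - f x - grad x \<bullet> h \<le> L / 2 * (norm h)\<^sup>2"
proof -
  \<comment> \<open>The quadratic term has derivative \<open>L * t * (norm h)\<^sup>2\<close>,
    exactly the allowed growth of the slope. Since \<open>g 0 = f x\<close>, the inequality between
    the endpoint values is the claim.\<close>
  define g where "g t = f (x + t *\<^sub>R h) - t * (grad x \<bullet> h) - L / 2 * t\<^sup>2 * (norm h)\<^sup>2" for t :: real
  have "g 0 \<ge> g 1"
  proof (rule DERIV_nonpos_imp_nonincreasing[where f = g])
    fix t :: real assume t: "0 \<le> t" "t \<le> 1"
    have "((\<lambda>t. f (x + t *\<^sub>R h)) has_derivative (\<lambda>s. grad (x + t *\<^sub>R h) \<bullet> (s *\<^sub>R h))) (at t)"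
      by (rule has_derivative_compose[OF _ deriv]) (auto intro!: derivative_eq_intros)
    then have "((\<lambda>t. f (x + t *\<^sub>R h)) has_real_derivative grad (x + t *\<^sub>R h) \<bullet> h) (at t)"
      by (rule has_derivative_imp_has_field_derivative) simp
    then have D: "(g has_real_derivative
        grad (x + t *\<^sub>R h) \<bullet> h - grad x \<bullet> h - L * t * (norm h)\<^sup>2) (at t)"
      unfolding g_def by (auto intro!: derivative_eq_intros)
    have "(grad (x + t *\<^sub>R h) - grad x) \<bullet> h \<le> norm (grad (x + t *\<^sub>R h) - grad x) * norm h"
      by (rule norm_cauchy_schwarz)
    also have "\<dots> \<le> (L * norm (t *\<^sub>R h)) * norm h"
      using lipschitz[of "x + t *\<^sub>R h" x] by (intro mult_right_mono) auto
    finally have "grad (x + t *\<^sub>R h) \<bullet> h - grad x \<bullet> h - L * t * (norm h)\<^sup>2 \<le> 0"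
      using t by (simp add: inner_diff_left power2_eq_square mult_ac)
    with D show "\<exists>y. (g has_real_derivative y) (at t) \<and> y \<le> 0" by blast
  qed simp
  then show ?thesis by (simp add: g_def)
qed

text \<open>The missing lower side is the upper bound for \<open>- f\<close>, whose gradient has the
  same Lipschitz constant.\<close>

lemma lipschitz_gradient_taylor_bound:
  fixes f :: "'a::euclidean_space \<Rightarrow> real"
  assumes deriv: "\<And>y. (f has_derivative (\<lambda>h. grad y \<bullet> h)) (at y)"
    and lipschitz: "\<And>y z. norm (grad y - grad z) \<le> L * norm (y - z)"
  shows "\<bar>f (x + h) - f x - grad x \<bullet> h\<bar> \<le> L / 2 * (norm h)\<^sup>2"
proof -
  have "- f (x + h) - - f x - (- grad x) \<bullet> h \<le> L / 2 * (norm h)\<^sup>2"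
  proof (rule lipschitz_gradient_upper_bound)
    show "((\<lambda>y. - f y) has_derivative (\<lambda>h. (- grad y) \<bullet> h)) (at y)" for y
      using has_derivative_minus[OF deriv[of y]] by simp
    show "norm (- grad y - - grad z) \<le> L * norm (y - z)" for y z
      using lipschitz[of y z] by (simp add: norm_minus_commute)
  qed
  with lipschitz_gradient_upper_bound[OF deriv lipschitz, of x h] show ?thesis
    by (intro abs_leI) simp_all
qed

section \<open>Gaussian integrals and the moment generating function\<close>

text \<open>Up to the factor \<open>sqrt (pi / c)\<close> the integrand is the centred normal
  density of variance \<open>1 / (2 * c)\<close>, which has total mass 1.\<close>

lemma nn_integral_exp_square:
  assumes "c > 0"
  shows "(\<integral>\<^sup>+x. ennreal (exp (- c * x\<^sup>2)) \<partial>lborel) = ennreal (sqrt (pi / c))"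
proof -
  define s where "s = 1 / sqrt (2 * c)"
  have s: "s > 0" "s\<^sup>2 = 1 / (2 * c)"
    using assms by (simp_all add: s_def power_divide)
  have eq: "exp (- c * x\<^sup>2) = sqrt (pi / c) * normal_density 0 s x" for x :: real
    using assms by (simp add: normal_density_def s real_sqrt_divide field_simps)
  have "(\<integral>\<^sup>+x. ennreal (normal_density 0 s x) \<partial>lborel) = 1"
    using prob_space.emeasure_space_1[OF prob_space_normal_density[OF s(1), of 0]]
    by (simp add: emeasure_density)
  then show ?thesis
    using assms by (simp only: eq) (simp add: ennreal_mult nn_integral_cmult)
qed

text \<open>The integrand factorises over the coordinates, so the integral is a product of
  \<open>DIM('a)\<close> equal one-dimensional ones.\<close>

lemma nn_integral_exp_norm_square:
  assumes "c > 0"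
  shows "(\<integral>\<^sup>+u. ennreal (exp (- c * (norm u)\<^sup>2)) \<partial>(lborel :: 'a::euclidean_space measure))
    = ennreal ((pi / c) powr (real DIM('a) / 2))"
proof -
  have "exp (- c * (norm u)\<^sup>2) = (\<Prod>b\<in>Basis. exp (- c * (u \<bullet> b)\<^sup>2))" for u :: 'a
    by (simp only: power2_norm_eq_inner)
      (subst euclidean_inner, simp add: exp_sum[symmetric] sum_distrib_left power2_eq_square sum_negf)
  then have "(\<integral>\<^sup>+u. ennreal (exp (- c * (norm u)\<^sup>2)) \<partial>(lborel :: 'a measure))
    = (\<integral>\<^sup>+u. (\<Prod>b\<in>Basis. ennreal (exp (- c * (u \<bullet> b)\<^sup>2))) \<partial>(lborel :: 'a measure))"
    by (simp add: prod_ennreal)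
  also have "\<dots> = (\<Prod>b\<in>(Basis :: 'a set). ennreal (sqrt (pi / c)))"
    by (subst nn_integral_lborel_prod) (simp_all only: nn_integral_exp_square[OF assms], auto)
  also have "\<dots> = ennreal (sqrt (pi / c) ^ DIM('a))"
    using assms by (simp add: ennreal_power)
  also have "sqrt (pi / c) ^ DIM('a) = (pi / c) powr (real DIM('a) / 2)"
    using assms by (simp add: powr_half_sqrt[symmetric] powr_realpow[symmetric] powr_powr)
  finally show ?thesis .
qed

lemma sets_std_gaussian [measurable_cong]: "sets std_gaussian = sets borel"
  by (simp add: std_gaussian_def)

text \<open>Multiplying by the density leaves the exponent
  \<open>- (1 / 2 - s) * (norm u)\<^sup>2\<close>; the condition on \<open>s\<close> makes this a
  convergent Gaussian integral. The case \<open>s = 0\<close> says that \<open>std_gaussian\<close>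
  has total mass 1.\<close>

lemma nn_integral_std_gaussian_exp_norm_square:
  assumes "s < 1 / 2"
  shows "(\<integral>\<^sup>+u. ennreal (exp (s * (norm u)\<^sup>2)) \<partial>(std_gaussian :: 'a::euclidean_space measure))
    = ennreal ((1 - 2 * s) powr (- real DIM('a) / 2))"
proof -
  define C where "C = (2 * pi) powr (- real DIM('a) / 2)"
  have "(\<integral>\<^sup>+u. ennreal (exp (s * (norm u)\<^sup>2)) \<partial>(std_gaussian :: 'a measure))
    = (\<integral>\<^sup>+u. ennreal C * ennreal (exp (- (1 / 2 - s) * (norm u)\<^sup>2)) \<partial>(lborel :: 'a measure))"
    unfolding std_gaussian_def C_def[symmetric]
    by (subst nn_integral_density)
      (auto intro!: nn_integral_cong
        simp: C_def ennreal_mult[symmetric] exp_add[symmetric] algebra_simps)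
  also have "\<dots> = ennreal C * (\<integral>\<^sup>+u. ennreal (exp (- (1 / 2 - s) * (norm u)\<^sup>2)) \<partial>(lborel :: 'a measure))"
    by (rule nn_integral_cmult) simp
  also have "\<dots> = ennreal (C * (pi / (1 / 2 - s)) powr (real DIM('a) / 2))"
    using assms by (subst nn_integral_exp_norm_square) (simp_all add: ennreal_mult C_def)
  also have "pi / (1 / 2 - s) = 2 * pi / (1 - 2 * s)"
    using assms by (simp add: field_simps)
  also have "C * (2 * pi / (1 - 2 * s)) powr (real DIM('a) / 2)
    = (1 - 2 * s) powr (- real DIM('a) / 2)"
    using assms by (simp add: C_def powr_divide powr_minus field_simps)
  finally show ?thesis .
qed

section \<open>Second and sixth moments of the Gaussian norm\<close>

text \<open>Integrating \<open>1 + t \<le> exp t\<close> at \<open>t = s * (norm u)\<^sup>2\<close>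
  bounds the moment by the difference quotient of the moment generating function at 0. As
  \<open>s\<close> decreases to 0 this quotient tends to the derivative, which is the
  dimension.\<close>

lemma nn_integral_std_gaussian_norm_square_le:
  "(\<integral>\<^sup>+u. ennreal ((norm u)\<^sup>2) \<partial>(std_gaussian :: 'a::euclidean_space measure)) \<le> ennreal (real DIM('a))"
proof -
  define n where "n = real DIM('a)"
  let ?I = "\<integral>\<^sup>+u. ennreal ((norm u)\<^sup>2) \<partial>(std_gaussian :: 'a measure)"
  have bound: "1 + ennreal s * ?I \<le> ennreal ((1 - 2 * s) powr (- n / 2))"
    if s: "0 < s" "s < 1 / 2" for s :: real
  proof -
    have "1 + ennreal s * ?I = (\<integral>\<^sup>+u. 1 + ennreal s * ennreal ((norm u)\<^sup>2) \<partial>(std_gaussian :: 'a measure))"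
      using nn_integral_std_gaussian_exp_norm_square[of 0, where 'a='a]
      by (simp add: nn_integral_add nn_integral_cmult)
    also have "\<dots> = (\<integral>\<^sup>+u. ennreal (1 + s * (norm u)\<^sup>2) \<partial>(std_gaussian :: 'a measure))"
      using s by (intro nn_integral_cong) (simp add: ennreal_mult)
    also have "\<dots> \<le> (\<integral>\<^sup>+u. ennreal (exp (s * (norm u)\<^sup>2)) \<partial>(std_gaussian :: 'a measure))"
      by (intro nn_integral_mono ennreal_leI exp_ge_add_one_self)
    finally show ?thesis
      using s by (simp add: nn_integral_std_gaussian_exp_norm_square n_def)
  qed
  \<comment> \<open>One admissible \<open>s\<close> already forces finiteness, which permits the
    passage to a real number \<open>m\<close> and a limit in the reals.\<close>
  have "?I \<noteq> \<top>"
    using bound[of "1/4"] by (auto simp: ennreal_mult_top top_unique)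
  then obtain m where m: "?I = ennreal m" "m \<ge> 0"
    by (cases ?I) auto
  have le: "m \<le> ((1 - 2 * s) powr (- n / 2) - 1) / s" if s: "0 < s" "s < 1 / 2" for s
  proof -
    have "ennreal (1 + s * m) \<le> ennreal ((1 - 2 * s) powr (- n / 2))"
      using bound[OF s] s m by (simp add: ennreal_mult)
    then have "1 + s * m \<le> (1 - 2 * s) powr (- n / 2)"
      by (subst (asm) ennreal_le_iff) auto
    then show ?thesis using s by (simp add: field_simps)
  qed
  have "((\<lambda>s. ((1 - 2 * s) powr (- n / 2) - 1) / s) \<longlongrightarrow> n) (at_right 0)"
    by real_asymp
  moreover have "\<forall>\<^sub>F s in at_right 0. m \<le> ((1 - 2 * s) powr (- n / 2) - 1) / s"
    using eventually_at_right_real[of 0 "1 / 2"] by (rule eventually_mono) (simp, intro le, auto)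
  ultimately have "m \<le> n"
    by (rule tendsto_lowerbound) simp
  then show ?thesis
    by (simp add: m n_def ennreal_leI)
qed

text \<open>This is \<open>1 + t \<le> exp t\<close> at \<open>t = s * r / 3 - 1\<close>, cubed;
  equality holds at \<open>r = 3 / s\<close>. With \<open>r = (norm u)\<^sup>2\<close> it bounds the
  sixth power by an exponential whose Gaussian integral is known.\<close>

lemma cube_le_exp:
  fixes r s :: real
  assumes "r \<ge> 0" "s > 0"
  shows "r ^ 3 \<le> (3 / s) ^ 3 * exp (-3) * exp (s * r)"
proof -
  have "s * r / 3 \<le> exp (s * r / 3 - 1)"
    using exp_ge_add_one_self[of "s * r / 3 - 1"] by simp
  then have "(s * r / 3) ^ 3 \<le> exp (s * r / 3 - 1) ^ 3"
    using assms by (intro power_mono) auto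
  also have "\<dots> = exp (-3) * exp (s * r)"
    by (simp add: exp_of_nat_mult[symmetric] exp_add[symmetric])
  finally show ?thesis
    using assms by (simp add: field_simps power_mult_distrib power_divide)
qed

text \<open>The value \<open>s = 3 / (n + 6)\<close> minimises the bound obtained from \<open>cube_le_exp\<close>.\<close>

lemma nn_integral_std_gaussian_norm_power6_le:
  "(\<integral>\<^sup>+u. ennreal ((norm u) ^ 6) \<partial>(std_gaussian :: 'a::euclidean_space measure))
    \<le> ennreal ((real DIM('a) + 6) ^ 3)"
proof -
  define n where "n = real DIM('a)"
  have n: "n > 0" by (simp add: n_def)
  define s where "s = 3 / (n + 6)"
  have s: "s > 0" "s < 1 / 2" "3 / s = n + 6" "1 - 2 * s = 1 / (1 + 6 / n)"
    using n by (simp_all add: s_def field_simps)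
  have "(\<integral>\<^sup>+u. ennreal ((norm u) ^ 6) \<partial>(std_gaussian :: 'a measure))
    \<le> (\<integral>\<^sup>+u. ennreal ((n + 6) ^ 3 * exp (-3)) * ennreal (exp (s * (norm u)\<^sup>2))
         \<partial>(std_gaussian :: 'a measure))"
  proof (rule nn_integral_mono)
    fix u :: 'a
    have "(norm u) ^ 6 \<le> (n + 6) ^ 3 * exp (-3) * exp (s * (norm u)\<^sup>2)"
      using cube_le_exp[of "(norm u)\<^sup>2" s] s by (simp flip: power_mult)
    then show "ennreal ((norm u) ^ 6) \<le> ennreal ((n + 6) ^ 3 * exp (-3)) * ennreal (exp (s * (norm u)\<^sup>2))"
      using n by (simp add: ennreal_mult[symmetric] ennreal_leI)
  qed
  also have "\<dots> = ennreal ((n + 6) ^ 3 * exp (-3) * (1 - 2 * s) powr (- n / 2))"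
    using s n by (subst nn_integral_cmult)
      (simp_all add: nn_integral_std_gaussian_exp_norm_square ennreal_mult n_def)
  also have "\<dots> \<le> ennreal ((n + 6) ^ 3)"
  proof (rule ennreal_leI)
    \<comment> \<open>By \<open>ln (1 + t) \<le> t\<close> at \<open>t = 6 / n\<close>, this factor
      is at most \<open>exp 3\<close>, which the factor \<open>exp (-3)\<close> from
      \<open>cube_le_exp\<close> cancels.\<close>
    have "(1 - 2 * s) powr (- n / 2) = exp (n / 2 * ln (1 + 6 / n))"
      using n add_pos_pos[of 1 "6 / n"] by (simp add: s powr_def ln_div)
    also have "\<dots> \<le> exp (n / 2 * (6 / n))"
      using n ln_add_one_self_le_self[of "6 / n"] by (intro exp_le_cancel_iff[THEN iffD2] mult_left_mono) auto
    also have "\<dots> = exp 3" using n by simp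
    finally have "exp (-3) * (1 - 2 * s) powr (- n / 2) \<le> 1"
      by (simp add: exp_minus field_simps)
    then have "(n + 6) ^ 3 * (exp (-3) * (1 - 2 * s) powr (- n / 2)) \<le> (n + 6) ^ 3 * 1"
      using n by (intro mult_left_mono) auto
    then show "(n + 6) ^ 3 * exp (-3) * (1 - 2 * s) powr (- n / 2) \<le> (n + 6) ^ 3"
      by (simp add: mult_ac)
  qed
  finally show ?thesis by (simp add: n_def)
qed

section \<open>Averaging over the noise\<close>

text \<open>The cross term of the expanded square vanishes because \<open>X\<close> has mean 0, and
  for the same reason the mean of its square is the variance.\<close>

lemma (in prob_space) nn_integral_shifted_centered_square:
  fixes X :: "'a \<Rightarrow> real"
  assumes X: "integrable M X" "integrable M (\<lambda>\<xi>. (X \<xi>)\<^sup>2)" "expectation X = 0"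
  shows "(\<integral>\<^sup>+\<xi>. ennreal ((c + b * X \<xi>)\<^sup>2) \<partial>M) = ennreal (c\<^sup>2 + b\<^sup>2 * variance X)"
proof -
  have eq: "(\<lambda>\<xi>. (c + b * X \<xi>)\<^sup>2) = (\<lambda>\<xi>. c\<^sup>2 + (2 * b * c) * X \<xi> + b\<^sup>2 * (X \<xi>)\<^sup>2)"
    by (simp add: fun_eq_iff power2_eq_square algebra_simps)
  have "integrable M (\<lambda>\<xi>. (c + b * X \<xi>)\<^sup>2)"
    unfolding eq using X by auto
  then have "(\<integral>\<^sup>+\<xi>. ennreal ((c + b * X \<xi>)\<^sup>2) \<partial>M) = ennreal (expectation (\<lambda>\<xi>. (c + b * X \<xi>)\<^sup>2))"
    by (intro nn_integral_eq_integral) auto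
  also have "expectation (\<lambda>\<xi>. (c + b * X \<xi>)\<^sup>2) = c\<^sup>2 + b\<^sup>2 * variance X"
    unfolding eq using X by (simp add: prob_space)
  finally show ?thesis .
qed

text \<open>Independence enters through the product measure: with \<open>\<xi>1\<close> fixed,
  \<open>c + b * X \<xi>1\<close> is a constant shift for the integral over \<open>\<xi>2\<close>.
  The one-variable lemma therefore applies twice, each time adding \<open>b\<^sup>2\<close> times a
  variance.\<close>

lemma (in prob_space) nn_integral_pair_shifted_centered_square:
  fixes X Y :: "'a \<Rightarrow> real"
  assumes X: "integrable M X" "integrable M (\<lambda>\<xi>. (X \<xi>)\<^sup>2)" "expectation X = 0"
    and Y: "integrable M Y" "integrable M (\<lambda>\<xi>. (Y \<xi>)\<^sup>2)" "expectation Y = 0"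
  shows "(\<integral>\<^sup>+(\<xi>1, \<xi>2). ennreal ((c + b * (X \<xi>1 - Y \<xi>2))\<^sup>2) \<partial>(M \<Otimes>\<^sub>M M))
    = ennreal (c\<^sup>2 + b\<^sup>2 * (variance X + variance Y))"
proof -
  have [measurable]: "X \<in> borel_measurable M" "Y \<in> borel_measurable M"
    using X Y by auto
  have "(\<integral>\<^sup>+(\<xi>1, \<xi>2). ennreal ((c + b * (X \<xi>1 - Y \<xi>2))\<^sup>2) \<partial>(M \<Otimes>\<^sub>M M))
    = (\<integral>\<^sup>+\<xi>1. \<integral>\<^sup>+\<xi>2. ennreal (((c + b * X \<xi>1) + (- b) * Y \<xi>2)\<^sup>2) \<partial>M \<partial>M)"
    by (subst nn_integral_fst[symmetric]) (simp_all add: algebra_simps)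
  also have "\<dots> = (\<integral>\<^sup>+\<xi>1. ennreal ((c + b * X \<xi>1)\<^sup>2) + ennreal (b\<^sup>2 * variance Y) \<partial>M)"
    by (subst nn_integral_shifted_centered_square[OF Y]) (simp add: variance_positive)
  also have "\<dots> = ennreal (c\<^sup>2 + b\<^sup>2 * variance X) + ennreal (b\<^sup>2 * variance Y)"
    by (subst nn_integral_add)
      (simp_all add: nn_integral_shifted_centered_square[OF X, unfolded X(3)] X(3) emeasure_space_1)
  also have "\<dots> = ennreal (c\<^sup>2 + b\<^sup>2 * (variance X + variance Y))"
    by (simp add: variance_positive algebra_simps flip: ennreal_plus)
  finally show ?thesis .
qed

section \<open>The optimal smoothing parameter\<close>

text \<open>At this \<open>\<mu>\<close> the Taylor term, growing with \<open>\<mu>\<close>, and the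
  noise term, decaying with it, coincide; each is half of the right-hand side. \<open>K\<close>
  stands for \<open>(n + 6) ^ 3\<close>.\<close>

lemma optimal_smoothing_balance:
  fixes L \<sigma> n K :: real
  assumes pos: "L > 0" "\<sigma> > 0" "n > 0" "K > 0"
  defines "\<mu> \<equiv> (8 * \<sigma>\<^sup>2 * n / (L\<^sup>2 * K)) powr (1 / 4)"
  shows "\<mu> > 0" "L\<^sup>2 * \<mu>\<^sup>2 / 4 * K + 2 * \<sigma>\<^sup>2 / \<mu>\<^sup>2 * n = sqrt 2 * L * \<sigma> * sqrt (n * K)"
proof -
  show "\<mu> > 0" using pos by (simp add: \<mu>_def)
  \<comment> \<open>Naming the square roots turns the remaining identities into rational ones in
    \<open>a\<close>, \<open>k\<close> and \<open>w\<close>.\<close>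
  define a where "a = sqrt n"
  define k where "k = sqrt K"
  define w where "w = sqrt (2 :: real)"
  have p: "a > 0" "k > 0" "w > 0" "n = a\<^sup>2" "K = k\<^sup>2" "w\<^sup>2 = 2"
    using pos by (simp_all add: a_def k_def w_def)
  have "\<mu>\<^sup>2 = \<mu> powr 2"
    using \<open>\<mu> > 0\<close> by simp
  also have "\<dots> = (8 * \<sigma>\<^sup>2 * n / (L\<^sup>2 * K)) powr (1 / 2)"
    unfolding \<mu>_def powr_powr by simp
  also have "\<dots> = sqrt ((2 * w * \<sigma> * a / (L * k))\<^sup>2)"
    using pos p by (simp add: powr_half_sqrt power_mult_distrib power_divide)
  also have "\<dots> = 2 * w * \<sigma> * a / (L * k)"
    using pos p by (subst real_sqrt_unique) auto
  finally have \<mu>2: "\<mu>\<^sup>2 = 2 * w * \<sigma> * a / (L * k)" .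
  have "L\<^sup>2 * \<mu>\<^sup>2 / 4 * K = w * L * \<sigma> * a * k / 2"
    unfolding \<mu>2 using pos p by (simp add: power2_eq_square field_simps)
  \<comment> \<open>Writing 2 as \<open>w\<^sup>2\<close> lets one factor \<open>w\<close> cancel
    against the one in \<open>\<mu>\<^sup>2\<close>.\<close>
  moreover have "2 * \<sigma>\<^sup>2 / \<mu>\<^sup>2 * n = w\<^sup>2 * \<sigma>\<^sup>2 * n / \<mu>\<^sup>2"
    using p by simp
  then have "2 * \<sigma>\<^sup>2 / \<mu>\<^sup>2 * n = w * L * \<sigma> * a * k / 2"
    unfolding \<mu>2 p(4) using pos p by (simp add: power2_eq_square field_simps)
  moreover have "sqrt (n * K) = a * k"
    by (simp add: a_def k_def real_sqrt_mult)
  ultimately show "L\<^sup>2 * \<mu>\<^sup>2 / 4 * K + 2 * \<sigma>\<^sup>2 / \<mu>\<^sup>2 * n = sqrt 2 * L * \<sigma> * sqrt (n * K)"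
    by (simp only: w_def)
qed

section \<open>Expected error of the noisy directional estimate\<close>

theorem theorem1:
  fixes f :: "'a::euclidean_space \<Rightarrow> real"
    and grad :: "'a \<Rightarrow> 'a"
    and L1 :: real
    and M :: "'b measure"
    and \<nu> :: "'a \<Rightarrow> 'b \<Rightarrow> real"
    and \<sigma> :: real
    and x :: 'a
  assumes convex: "convex_on UNIV f"
    and deriv: "\<And>y. (f has_derivative (\<lambda>h. grad y \<bullet> h)) (at y)"
    and grad_cont: "continuous_on UNIV grad"
    and L1_pos: "L1 > 0"
    and lipschitz: "\<And>y z. norm (grad y - grad z) \<le> L1 * norm (y - z)"
    and prob: "prob_space M"
    and \<nu>_meas: "(\<lambda>(y, \<xi>). \<nu> y \<xi>) \<in> borel_measurable (borel \<Otimes>\<^sub>M M)"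
    and \<nu>_int: "\<And>y. integrable M (\<nu> y)"
    and \<nu>_sq_int: "\<And>y. integrable M (\<lambda>\<xi>. (\<nu> y \<xi>)\<^sup>2)"
    and \<nu>_mean: "\<And>y. prob_space.expectation M (\<nu> y) = 0"
    and \<nu>_var: "\<And>y. prob_space.variance M (\<nu> y) = \<sigma>\<^sup>2"
    and \<sigma>_pos: "\<sigma> > 0"
  shows "(let n = real DIM('a);
              \<mu> = (8 * \<sigma>\<^sup>2 * n / (L1\<^sup>2 * (n + 6) ^ 3)) powr (1 / 4);
              ft = (\<lambda>y \<xi>. f y + \<nu> y \<xi>)
          in (\<integral>\<^sup>+ (u, \<xi>1, \<xi>2). ennreal
                 ((norm (((ft (x + \<mu> *\<^sub>R u) \<xi>1 - ft x \<xi>2) / \<mu>) *\<^sub>R u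
                          - (grad x \<bullet> u) *\<^sub>R u))\<^sup>2)
               \<partial>(std_gaussian \<Otimes>\<^sub>M (M \<Otimes>\<^sub>M M)))
             \<le> ennreal (sqrt 2 * L1 * \<sigma> * sqrt (n * (n + 6) ^ 3)))"
proof -
  interpret M: prob_space M by (rule prob)
  interpret MM: pair_prob_space M M ..
  define n where "n = real DIM('a)"
  define \<mu> where "\<mu> = (8 * \<sigma>\<^sup>2 * n / (L1\<^sup>2 * (n + 6) ^ 3)) powr (1 / 4)"
  have n: "n > 0" by (simp add: n_def)
  have \<mu>: "\<mu> > 0"
    and balance: "L1\<^sup>2 * \<mu>\<^sup>2 / 4 * (n + 6) ^ 3 + 2 * \<sigma>\<^sup>2 / \<mu>\<^sup>2 * n
      = sqrt 2 * L1 * \<sigma> * sqrt (n * (n + 6) ^ 3)"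
    unfolding \<mu>_def using L1_pos \<sigma>_pos n by (intro optimal_smoothing_balance; simp)+
  have "continuous_on UNIV f"
    by (intro continuous_at_imp_continuous_on ballI has_derivative_continuous[OF deriv])
  then have f_meas [measurable]: "f \<in> borel_measurable borel"
    by (rule borel_measurable_continuous_onI)
  have [measurable]: "\<nu> y \<in> borel_measurable M" for y
    using \<nu>_int by auto
  \<comment> \<open>Here the noise is evaluated at a random point, so joint measurability of
    \<open>\<nu>\<close> in both arguments is used.\<close>
  have [measurable]: "(\<lambda>p. \<nu> (x + \<mu> *\<^sub>R fst p) (fst (snd p)))
      \<in> borel_measurable ((std_gaussian :: 'a measure) \<Otimes>\<^sub>M (M \<Otimes>\<^sub>M M))"
    using measurable_compose[OF measurable_Pair \<nu>_meas,
        of "\<lambda>p. x + \<mu> *\<^sub>R fst p" "std_gaussian \<Otimes>\<^sub>M (M \<Otimes>\<^sub>M M)" "\<lambda>p. fst (snd p)"]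
    by simp
  \<comment> \<open>The noise-free part of the error: the Taylor remainder at step
    \<open>\<mu> *\<^sub>R u\<close>, divided by \<open>\<mu>\<close>.\<close>
  define r where "r u = (f (x + \<mu> *\<^sub>R u) - f x) / \<mu> - grad x \<bullet> u" for u
  have r: "(r u)\<^sup>2 \<le> L1\<^sup>2 * \<mu>\<^sup>2 / 4 * (norm u) ^ 4" for u
  proof -
    have "r u = (f (x + \<mu> *\<^sub>R u) - f x - grad x \<bullet> (\<mu> *\<^sub>R u)) / \<mu>"
      using \<mu> by (simp add: r_def field_simps)
    then have "\<bar>r u\<bar> = \<bar>f (x + \<mu> *\<^sub>R u) - f x - grad x \<bullet> (\<mu> *\<^sub>R u)\<bar> / \<mu>"
      using \<mu> by simp
    also have "\<dots> \<le> (L1 / 2 * (norm (\<mu> *\<^sub>R u))\<^sup>2) / \<mu>"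
      using \<mu> by (intro divide_right_mono lipschitz_gradient_taylor_bound deriv lipschitz) simp
    also have "\<dots> = L1 * \<mu> / 2 * (norm u)\<^sup>2"
      using \<mu> by (simp add: power2_eq_square)
    finally have "\<bar>r u\<bar>\<^sup>2 \<le> (L1 * \<mu> / 2 * (norm u)\<^sup>2)\<^sup>2"
      by (intro power_mono) auto
    then show ?thesis by (simp add: power_mult_distrib power_divide flip: power_mult)
  qed
  let ?E = "\<lambda>u \<xi>1 \<xi>2. (norm (((f (x + \<mu> *\<^sub>R u) + \<nu> (x + \<mu> *\<^sub>R u) \<xi>1 - (f x + \<nu> x \<xi>2)) / \<mu>) *\<^sub>R u
                          - (grad x \<bullet> u) *\<^sub>R u))\<^sup>2"
  \<comment> \<open>Both vectors in the error are multiples of \<open>u\<close>, so a scalar square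
    remains, in the form \<open>c + b * (X - Y)\<close> with \<open>c = r u\<close> and
    \<open>b = 1 / \<mu>\<close>.\<close>
  have E: "?E u \<xi>1 \<xi>2 = (norm u)\<^sup>2 * (r u + (1 / \<mu>) * (\<nu> (x + \<mu> *\<^sub>R u) \<xi>1 - \<nu> x \<xi>2))\<^sup>2" for u \<xi>1 \<xi>2
  proof -
    have "((f (x + \<mu> *\<^sub>R u) + \<nu> (x + \<mu> *\<^sub>R u) \<xi>1 - (f x + \<nu> x \<xi>2)) / \<mu>) *\<^sub>R u - (grad x \<bullet> u) *\<^sub>R u
      = (r u + (1 / \<mu>) * (\<nu> (x + \<mu> *\<^sub>R u) \<xi>1 - \<nu> x \<xi>2)) *\<^sub>R u"
      by (simp add: r_def diff_divide_distrib add_divide_distrib flip: scaleR_diff_left)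
    then show ?thesis by (simp add: power_mult_distrib)
  qed
  \<comment> \<open>For fixed \<open>u\<close> the noise average contributes two variances, hence
    \<open>2 * \<sigma>\<^sup>2 / \<mu>\<^sup>2\<close>; the outer \<open>(norm u)\<^sup>2\<close>
    raises the fourth power in the bound on \<open>r\<close> to the sixth.\<close>
  have inner: "(\<integral>\<^sup>+(\<xi>1, \<xi>2). ennreal (?E u \<xi>1 \<xi>2) \<partial>(M \<Otimes>\<^sub>M M))
    \<le> ennreal (L1\<^sup>2 * \<mu>\<^sup>2 / 4) * ennreal ((norm u) ^ 6) + ennreal (2 * \<sigma>\<^sup>2 / \<mu>\<^sup>2) * ennreal ((norm u)\<^sup>2)"
    for u
  proof -
    have "(\<integral>\<^sup>+(\<xi>1, \<xi>2). ennreal (?E u \<xi>1 \<xi>2) \<partial>(M \<Otimes>\<^sub>M M))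
      = (\<integral>\<^sup>+p. ennreal ((norm u)\<^sup>2) *
          (case p of (\<xi>1, \<xi>2) \<Rightarrow> ennreal ((r u + (1 / \<mu>) * (\<nu> (x + \<mu> *\<^sub>R u) \<xi>1 - \<nu> x \<xi>2))\<^sup>2))
          \<partial>(M \<Otimes>\<^sub>M M))"
      by (intro nn_integral_cong) (auto simp: E ennreal_mult split: prod.split)
    also have "\<dots> = ennreal ((norm u)\<^sup>2) * ennreal ((r u)\<^sup>2 + (1 / \<mu>)\<^sup>2 * (\<sigma>\<^sup>2 + \<sigma>\<^sup>2))"
      by (subst nn_integral_cmult)
        (simp_all only: M.nn_integral_pair_shifted_centered_square[OF \<nu>_int \<nu>_sq_int \<nu>_mean \<nu>_int \<nu>_sq_int \<nu>_mean]
          \<nu>_var, measurable)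
    also have "\<dots> = ennreal ((norm u)\<^sup>2 * ((r u)\<^sup>2 + (1 / \<mu>)\<^sup>2 * (\<sigma>\<^sup>2 + \<sigma>\<^sup>2)))"
      by (simp add: ennreal_mult)
    also have "\<dots> \<le> ennreal ((norm u)\<^sup>2 * (L1\<^sup>2 * \<mu>\<^sup>2 / 4 * (norm u) ^ 4 + (1 / \<mu>)\<^sup>2 * (\<sigma>\<^sup>2 + \<sigma>\<^sup>2)))"
      by (intro ennreal_leI mult_left_mono add_right_mono r) auto
    also have "(norm u)\<^sup>2 * (L1\<^sup>2 * \<mu>\<^sup>2 / 4 * (norm u) ^ 4 + (1 / \<mu>)\<^sup>2 * (\<sigma>\<^sup>2 + \<sigma>\<^sup>2))
      = L1\<^sup>2 * \<mu>\<^sup>2 / 4 * (norm u) ^ 6 + 2 * \<sigma>\<^sup>2 / \<mu>\<^sup>2 * (norm u)\<^sup>2"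
      by (simp add: algebra_simps power_divide flip: power_add)
    finally show ?thesis
      by (simp only: ennreal_plus ennreal_mult zero_le_power norm_ge_zero zero_le_power2
          zero_le_divide_iff mult_nonneg_nonneg zero_le_numeral simp_thms)
  qed
  \<comment> \<open>Tonelli puts the integral over \<open>u\<close> outside, so that
    \<open>inner\<close> applies pointwise and only the two Gaussian moments remain.\<close>
  have "(\<integral>\<^sup>+(u, \<xi>1, \<xi>2). ennreal (?E u \<xi>1 \<xi>2) \<partial>(std_gaussian \<Otimes>\<^sub>M (M \<Otimes>\<^sub>M M)))
    = (\<integral>\<^sup>+u. \<integral>\<^sup>+(\<xi>1, \<xi>2). ennreal (?E u \<xi>1 \<xi>2) \<partial>(M \<Otimes>\<^sub>M M) \<partial>std_gaussian)"
    by (subst MM.nn_integral_fst[symmetric]) (simp_all add: case_prod_beta')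
  also have "\<dots> \<le> (\<integral>\<^sup>+u. ennreal (L1\<^sup>2 * \<mu>\<^sup>2 / 4) * ennreal ((norm u) ^ 6)
      + ennreal (2 * \<sigma>\<^sup>2 / \<mu>\<^sup>2) * ennreal ((norm u)\<^sup>2) \<partial>(std_gaussian :: 'a measure))"
    by (intro nn_integral_mono inner)
  also have "\<dots> = ennreal (L1\<^sup>2 * \<mu>\<^sup>2 / 4) * (\<integral>\<^sup>+u. ennreal ((norm u) ^ 6) \<partial>(std_gaussian :: 'a measure))
      + ennreal (2 * \<sigma>\<^sup>2 / \<mu>\<^sup>2) * (\<integral>\<^sup>+u. ennreal ((norm u)\<^sup>2) \<partial>(std_gaussian :: 'a measure))"
    by (simp add: nn_integral_add nn_integral_cmult)
  also have "\<dots> \<le> ennreal (L1\<^sup>2 * \<mu>\<^sup>2 / 4) * ennreal ((n + 6) ^ 3) + ennreal (2 * \<sigma>\<^sup>2 / \<mu>\<^sup>2) * ennreal n"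
    unfolding n_def by (intro add_mono mult_left_mono nn_integral_std_gaussian_norm_power6_le
        nn_integral_std_gaussian_norm_square_le) auto
  also have "\<dots> = ennreal (L1\<^sup>2 * \<mu>\<^sup>2 / 4 * (n + 6) ^ 3 + 2 * \<sigma>\<^sup>2 / \<mu>\<^sup>2 * n)"
    using n by (simp flip: ennreal_mult ennreal_plus)
  finally show ?thesis
    unfolding balance Let_def n_def[symmetric] \<mu>_def[symmetric] .
qed

end
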